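(* Let $H(V,E)$ be the complete $r$-uniform hypergraph with $n$ vertices ($1\le r\le n$). If $r>\lfloor n/2\rfloor$, then the total edge-domatic number of $H$ is $ed_t(H)=\left\lfloor \binom{n}{r}/2\right\rfloor$.
   Context: A hypergraph $H(V,E)$ has a finite vertex set $V$ and a set $E$ of hyperedges, each a subset of $V$; it is $r$-uniform if every hyperedge has exactly $r$ vertices. The complete $r$-uniform hypergraph on $n$ vertices has as hyperedges all $r$-element subsets of $V$. Two distinct hyperedges are adjacent if they share at least one vertex; a hyperedge is not adjacent to itself. A total edge-dominating set is a subset $E_t\subseteq E$ such that every hyperedge in $E$ is adjacent to some hyperedge in $E_t$. The total edge-domatic number $ed_t(H)$ is the maximum number of classes in a partition of $E$ into total edge-dominating sets. *)

theory Defs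
  imports Main "HOL-Library.Disjoint_Sets"
begin

definition hypergraph :: "'a set \<Rightarrow> 'a set set \<Rightarrow> bool" where
  "hypergraph V E \<longleftrightarrow> finite V \<and> (\<forall>e\<in>E. e \<subseteq> V)"

definition uniform_hypergraph :: "nat \<Rightarrow> 'a set \<Rightarrow> 'a set set \<Rightarrow> bool" where
  "uniform_hypergraph r V E \<longleftrightarrow> hypergraph V E \<and> (\<forall>e\<in>E. card e = r)"

definition complete_uniform_hypergraph :: "nat \<Rightarrow> 'a set \<Rightarrow> 'a set set \<Rightarrow> bool" where
  "complete_uniform_hypergraph r V E \<longleftrightarrow>
     uniform_hypergraph r V E \<and> (\<forall>e. e \<subseteq> V \<and> card e = r \<longrightarrow> e \<in> E)"

definition edge_adjacent :: "'a set \<Rightarrow> 'a set \<Rightarrow> bool" where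
  "edge_adjacent e f \<longleftrightarrow> e \<noteq> f \<and> e \<inter> f \<noteq> {}"

definition total_edge_dominating :: "'a set set \<Rightarrow> 'a set set \<Rightarrow> bool" where
  "total_edge_dominating E T \<longleftrightarrow> T \<subseteq> E \<and> (\<forall>e\<in>E. \<exists>f\<in>T. edge_adjacent e f)"

text \<open>
  For finite \<open>E\<close> the set below is finite, so the supremum is the maximum whenever some
  partition into total edge-dominating sets exists. If none exists (for instance if \<open>E\<close>
  consists of a single hyperedge), the number of classes is \<open>0\<close>, which is the value of
  \<open>Sup {}\<close> on type \<open>nat\<close>.
\<close>

definition total_edge_domatic_number :: "'a set set \<Rightarrow> nat" where
  "total_edge_domatic_number E =
     Sup {card P | P. partition_on E P \<and> (\<forall>T\<in>P. total_edge_dominating E T)}"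

end

theory Submission
  imports Defs
begin

text \<open>
  Since \<open>2 * r > n\<close>, any two hyperedges meet, so adjacency is just distinctness and a set of
  hyperedges is total edge-dominating as soon as it has two elements. Conversely a nonempty
  total edge-dominating set needs two elements. Hence the number sought is the largest number
  of classes of size at least two in a partition of \<open>E\<close>.
\<close>

text \<open>Pairs are split off one at a time, and an odd leftover element joins the last class,
  making it a triple. A singleton has to be excluded: its only partition has one class, of size
  1.\<close>

lemma ex_partition_on_card_ge_2:
  assumes "finite A" and "card A \<noteq> 1"
  shows "\<exists>P. partition_on A P \<and> card P = card A div 2 \<and> (\<forall>T\<in>P. 2 \<le> card T)"
  using assms
proof (induction "card A" arbitrary: A rule: less_induct)
  case less
  \<comment> \<open>A pair is removed only from 4 elements on, so that the remainder never has size
    1 and the induction hypothesis applies. Sets of size 2 or 3 form a single class.\<close>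
  consider "card A = 0" | "2 \<le> card A" "card A < 4" | "4 \<le> card A"
    using less.prems by linarith
  then show ?case
  proof cases
    case 1
    then show ?thesis
      using less.prems by (auto simp: partition_on_empty)
  next
    case 2
    then have "A \<noteq> {}" "card A div 2 = 1"
      by auto
    then show ?thesis
      using 2 by (intro exI[of _ "{A}"]) (auto simp: partition_on_space)
  next
    case 3
    then have "2 \<le> card A"
      by simp
    then obtain B where B: "B \<subseteq> A" "card B = 2"
      using obtain_subset_with_card_n by blast
    then have "finite B" "B \<noteq> {}"
      using less.prems(1) by (auto intro: rev_finite_subset)
    have cD: "card (A - B) = card A - 2"
      using B \<open>finite B\<close> by (simp add: card_Diff_subset)
    then have "card (A - B) < card A" "card (A - B) \<noteq> 1"
      using 3 by linarith+
    then obtain P where P: "partition_on (A - B) P" "card P = card (A - B) div 2"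
        "\<forall>T\<in>P. 2 \<le> card T"
      using less.hyps[of "A - B"] less.prems(1) by auto
    have "finite P"
      using P(1) less.prems(1) finite_elements by blast
    moreover have "B \<notin> P"
      using P(1) \<open>B \<noteq> {}\<close> by (auto simp: partition_on_def)
    ultimately have "card (insert B P) = card A div 2"
      using P(2) cD 3 by simp
    moreover have "disjnt B (\<Union>P)"
      using P(1) by (auto simp: partition_on_def disjnt_def)
    then have "partition_on A (insert B P)"
      using P(1) B(1) \<open>B \<noteq> {}\<close> by (simp add: partition_on_insert)
    ultimately show ?thesis
      using P(3) B(2) by (intro exI[of _ "insert B P"]) auto
  qed
qed

text \<open>Total domination also covers the members of \<open>T\<close> themselves: a member needs
  a neighbour in \<open>T\<close>, and no hyperedge is adjacent to itself.\<close>

lemma total_edge_dominating_card_ge_2: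
  assumes "finite E" and "total_edge_dominating E T" and "T \<noteq> {}"
  shows "2 \<le> card T"
proof -
  obtain e where "e \<in> T"
    using assms(3) by blast
  moreover obtain f where "f \<in> T" "e \<noteq> f"
    using assms(2) \<open>e \<in> T\<close> unfolding total_edge_dominating_def edge_adjacent_def by blast
  moreover have "finite T"
    using assms(1,2) finite_subset unfolding total_edge_dominating_def by blast
  ultimately show ?thesis
    using card_mono[of T "{e, f}"] by simp
qed

text \<open>The class sizes add up to \<open>card E\<close>, and each is at least 2 because the
  classes of a partition are nonempty.\<close>

lemma card_total_edge_dominating_partition_le:
  assumes "finite E" and "partition_on E P" and "\<forall>T\<in>P. total_edge_dominating E T"
  shows "card P \<le> card E div 2"
proof -
  have "card P * 2 = (\<Sum>T\<in>P. 2)"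
    by simp
  also have "\<dots> \<le> (\<Sum>T\<in>P. card T)"
    using assms by (intro sum_mono total_edge_dominating_card_ge_2) (auto simp: partition_on_def)
  also have "\<dots> = card E"
    using assms(1,2)
    by (intro product_partition[symmetric]) (auto simp: partition_on_def intro: rev_finite_subset)
  finally show ?thesis
    by simp
qed

text \<open>Whatever \<open>e\<close> is, \<open>T\<close> does not fit into \<open>{e}\<close>, so
  it has a member other than \<open>e\<close>, which meets \<open>e\<close> by the first
  assumption.\<close>

lemma total_edge_dominating_if_intersecting:
  assumes "\<And>e f. e \<in> E \<Longrightarrow> f \<in> E \<Longrightarrow> e \<inter> f \<noteq> {}" and "T \<subseteq> E" and "2 \<le> card T"
  shows "total_edge_dominating E T"
proof -
  have distinct: "\<exists>f\<in>T. e \<noteq> f" for e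
  proof (rule ccontr)
    assume "\<not> (\<exists>f\<in>T. e \<noteq> f)"
    then have "card T \<le> card {e}"
      by (intro card_mono) auto
    with assms(3) show False
      by simp
  qed
  show ?thesis
    unfolding total_edge_dominating_def edge_adjacent_def
  proof (intro conjI ballI)
    fix e
    assume "e \<in> E"
    obtain f where "f \<in> T" "e \<noteq> f"
      using distinct[of e] by blast
    with \<open>e \<in> E\<close> show "\<exists>f\<in>T. e \<noteq> f \<and> e \<inter> f \<noteq> {}"
      using assms(1)[of e f] assms(2) by auto
  qed (rule assms(2))
qed

lemma total_edge_domatic_number_intersecting:
  assumes "finite E" and "\<And>e f. e \<in> E \<Longrightarrow> f \<in> E \<Longrightarrow> e \<inter> f \<noteq> {}"
  shows "total_edge_domatic_number E = card E div 2"
proof -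
  let ?X = "{card P | P. partition_on E P \<and> (\<forall>T\<in>P. total_edge_dominating E T)}"
  have upper: "x \<le> card E div 2" if "x \<in> ?X" for x
    using that card_total_edge_dominating_partition_le[OF assms(1)] by auto
  have "Sup ?X = card E div 2"
  \<comment> \<open>With a single hyperedge (in the theorem, \<open>r = n\<close>) there is no
    partition to exhibit. The upper bound is then 0, so the supremum is 0 even if \<open>?X\<close>
    is empty, by the default value of \<open>Sup {}\<close>; this agrees with
    \<open>1 div 2 = 0\<close>.\<close>
  proof (cases "card E = 1")
    case True
    then have "?X \<subseteq> {0}"
      using upper by fastforce
    then have "?X = {} \<or> ?X = {0}"
      by (rule subset_singletonD)
    then have "Sup ?X = 0"
      by (elim disjE) (simp_all only: Sup_nat_empty cSup_singleton)
    then show ?thesis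
      using True by simp
  next
    case False
    then obtain P where P: "partition_on E P" "card P = card E div 2" "\<forall>T\<in>P. 2 \<le> card T"
      using ex_partition_on_card_ge_2[OF assms(1)] by blast
    have "total_edge_dominating E T" if "T \<in> P" for T
      using that P assms(2) by (intro total_edge_dominating_if_intersecting) (auto simp: partition_on_def)
    then have "card E div 2 \<in> ?X"
      using P by force
    then show ?thesis
      using upper by (rule cSup_eq_maximum)
  qed
  then show ?thesis
    unfolding total_edge_domatic_number_def .
qed

theorem theorem9:
  fixes V :: "'a set" and E :: "'a set set" and n r :: nat
  assumes "complete_uniform_hypergraph r V E"
    and "card V = n"
    and "1 \<le> r" and "r \<le> n"
    and "r > n div 2"
  shows "total_edge_domatic_number E = (n choose r) div 2"
proof -
  have E: "E = {e. e \<subseteq> V \<and> card e = r}" and "finite V"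
    using assms(1) unfolding complete_uniform_hypergraph_def uniform_hypergraph_def hypergraph_def
    by blast+
  \<comment> \<open>Disjoint hyperedges would occupy \<open>2 * r\<close> vertices, but
    \<open>r > n div 2\<close> gives \<open>2 * r > n\<close> for either parity of \<open>n\<close>.
    The case \<open>e = f\<close> is covered too.\<close>
  have "e \<inter> f \<noteq> {}" if "e \<in> E" "f \<in> E" for e f
  proof
    assume "e \<inter> f = {}"
    moreover have "finite e" "finite f" "card e = r" "card f = r" "e \<union> f \<subseteq> V"
      using that \<open>finite V\<close> by (auto simp: E intro: rev_finite_subset)
    ultimately have "r + r \<le> n"
      using card_Un_disjoint[of e f] card_mono[OF \<open>finite V\<close>, of "e \<union> f"] assms(2) by simp
    then show False
      using assms(5) by linarith
  qed
  moreover have "finite E"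
    using \<open>finite V\<close> by (simp add: E)
  moreover have "card E = n choose r"
    using n_subsets[OF \<open>finite V\<close>] assms(2) by (simp add: E)
  ultimately show ?thesis
    using total_edge_domatic_number_intersecting[of E] by simp
qed

end
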